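(* Let $A,\bar A\in\mathbb R^{n\times n}$, $B,\bar B\in\mathbb R^{n\times m}$ with $\operatorname{rank}(\bar B)=n$; fix an invertible $M\in\mathbb R^{m\times m}$ with $\bar BM=[\,I_n\ \ 0\,]$ and write $BM=[\,L\ \ F\,]$ with $L\in\mathbb R^{n\times n}$, $F\in\mathbb R^{n\times (m-n)}$. Assume $A-L\bar A$ is invertible and put $C=(A-L\bar A)^{-1}$, $\bar C=-(A-L\bar A)^{-1}L$, $D=-(A-L\bar A)^{-1}F$. Then the system governed by the backward stochastic difference equation $$x(k)=Cx(k+1)+\bar Cz(k)+Dv(k)-Cw(k)z(k)$$ is exactly null controllable if and only if $\operatorname{rank}(R)=n$, where $$R=[\,D\ \ CD\ \ \bar CD\ \ C^2D\ \ \bar C^2D\ \ C\bar CD\ \ \bar CCD\ \cdots]$$ is the matrix with infinitely many columns whose blocks are all matrices $WD$, $W$ running over all finite products (words, including the empty word $I_n$) of the matrices $C$ and $\bar C$.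
   Context: $w(0),w(1),\dots$ are i.i.d. real random variables with zero mean and unit variance on a complete probability space; $\mathcal F(k)=\sigma\{w(0),\dots,w(k)\}$ and $\mathcal F(-1)$ is trivial. $[0,N]=\{0,1,\dots,N\}$. $l^2_{\mathcal F}([0,N],\mathbb R^s)$ is the space of processes $(m(k))_{k\in[0,N]}$ with $m(k)$ an $\mathbb R^s$-valued square integrable $\mathcal F(k-1)$-measurable random vector for each $k$. The backward system is exactly null controllable if for every nonzero $x\in\mathbb R^n$ there exist a positive integer $N$, a control $v\in l^2_{\mathcal F}([0,N],\mathbb R^{m-n})$, and processes $(x(k))_{k\in[0,N+1]}\in l^2_{\mathcal F}([0,N+1],\mathbb R^n)$, $(z(k))_{k\in[0,N]}\in l^2_{\mathcal F}([0,N],\mathbb R^n)$ satisfying the backward equation for all $k\in[0,N]$ (a.s.), with $x(0)=x$ and $x(N+1)=0$. (This backward equation is a rewriting of the forward system $x(k+1)=[Ax(k)+Bu(k)]+w(k)[\bar Ax(k)+\bar Bu(k)]$ via $u(k)=M\,[q(k)'\ \ v(k)']'$, $z(k)=\bar Ax(k)+q(k)$, prime denoting transpose.) *)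

theory Defs
  imports "HOL-Probability.Probability" "Jordan_Normal_Form.DL_Rank"
    "Jordan_Normal_Form.Gauss_Jordan_Elimination"
begin

text \<open>
  Vectors and matrices are those of \<^theory>\<open>Jordan_Normal_Form.Matrix\<close>, whose dimensions are
  natural numbers; the case \<open>m = n\<close>, where the control takes values in \<open>\<real>\<^sup>0\<close>, is therefore included.
\<close>

unbundle no vec_syntax

definition append_cols :: "'a::zero mat \<Rightarrow> 'a mat \<Rightarrow> 'a mat" where
  "append_cols A B = four_block_mat A B (0\<^sub>m 0 (dim_col A)) (0\<^sub>m 0 (dim_col B))"

text \<open>
  Rank of a matrix with possibly infinitely many columns, given by its set of columns: as for
  \<open>vec_space.rank\<close>, the dimension of the space spanned by the columns.
\<close>

definition (in vec_space) rank_of_cols :: "'a vec set \<Rightarrow> nat" where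
  "rank_of_cols S = vectorspace.dim class_ring (span_vs S)"

definition word_mat :: "nat \<Rightarrow> real mat list \<Rightarrow> real mat" where
  "word_mat n Ws = foldr (*) Ws (1\<^sub>m n)"

definition R_cols :: "nat \<Rightarrow> real mat \<Rightarrow> real mat \<Rightarrow> real mat \<Rightarrow> real vec set" where
  "R_cols n C Cbar D = (\<Union>Ws \<in> lists {C, Cbar}. set (cols (word_mat n Ws * D)))"

text \<open>The \<open>\<sigma>\<close>-algebra generated by \<open>w 0, \<dots>, w k\<close>; it is trivial for \<open>k = -1\<close>.\<close>

definition \<F> :: "'a measure \<Rightarrow> (nat \<Rightarrow> 'a \<Rightarrow> real) \<Rightarrow> int \<Rightarrow> 'a measure" where
  "\<F> P w k = sigma (space P) {w j -` S \<inter> space P | j S. int j \<le> k \<and> S \<in> sets borel}"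

text \<open>
  Processes indexed by \<open>{0..N}\<close>; values at indices beyond \<open>N\<close> are irrelevant. Measurability and
  square integrability of random vectors are expressed through their components.
\<close>

definition l2_adapted ::
    "'a measure \<Rightarrow> (nat \<Rightarrow> 'a \<Rightarrow> real) \<Rightarrow> nat \<Rightarrow> nat \<Rightarrow> (nat \<Rightarrow> 'a \<Rightarrow> real vec) set" where
  "l2_adapted P w N s = {y. \<forall>k\<in>{0..N}.
     (\<forall>\<omega>\<in>space P. y k \<omega> \<in> carrier_vec s) \<and>
     (\<forall>i<s. (\<lambda>\<omega>. y k \<omega> $ i) \<in> borel_measurable (\<F> P w (int k - 1)) \<and>
            integrable P (\<lambda>\<omega>. (y k \<omega> $ i)\<^sup>2))}"

definition exactly_null_controllable ::
    "'a measure \<Rightarrow> (nat \<Rightarrow> 'a \<Rightarrow> real) \<Rightarrow> nat \<Rightarrow> nat \<Rightarrow> real mat \<Rightarrow> real mat \<Rightarrow> real mat \<Rightarrow> bool" where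
  "exactly_null_controllable P w n p C Cbar D \<longleftrightarrow>
     (\<forall>x0 \<in> carrier_vec n. x0 \<noteq> 0\<^sub>v n \<longrightarrow>
       (\<exists>N>0. \<exists>v \<in> l2_adapted P w N p. \<exists>x \<in> l2_adapted P w (N + 1) n. \<exists>z \<in> l2_adapted P w N n.
          (\<forall>k\<in>{0..N}. AE \<omega> in P.
             x k \<omega> = C *\<^sub>v x (k + 1) \<omega> + Cbar *\<^sub>v z k \<omega> + D *\<^sub>v v k \<omega>
                     - C *\<^sub>v (w k \<omega> \<cdot>\<^sub>v z k \<omega>)) \<and>
          (AE \<omega> in P. x 0 \<omega> = x0) \<and>
          (AE \<omega> in P. x (N + 1) \<omega> = 0\<^sub>v n)))"

end

theory Submission
  imports Defs
begin

text \<open>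
  Necessity is proved by duality. If \<open>l\<close> annihilates all \<open>W D\<close> and every such \<open>l\<close> is
  orthogonal to \<open>x (k + 1)\<close>, then pairing the equation with \<open>(C\<inverse>)\<^sup>T l\<close> leaves an identity
  \<open>f + w k * (l \<bullet> z k) = 0\<close> with \<open>f\<close> and \<open>z k\<close> measurable with respect to the past. The two
  summands are orthogonal in \<open>L\<^sup>2\<close>, so \<open>l \<bullet> z k = 0\<close>; pairing the equation with \<open>l\<close> itself then
  gives \<open>l \<bullet> x k = 0\<close>. Hence \<open>l \<bullet> x 0 = 0\<close> for every initial state, that is \<open>l = 0\<close>.

  For sufficiency, the state \<open>W D u\<close> is steered to zero by stripping off one letter of \<open>W\<close> at each
  step and applying the control \<open>u\<close>, up to a product of past noises, when the word is exhausted;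
  solutions can be added.
\<close>

unbundle no inner_syntax

unbundle no inner_syntax

section \<open>Linear algebra: spans, rank and orthogonal vectors\<close>

context vec_space
begin

text \<open>Independent sets have at most \<open>n\<close> elements, so a maximal independent subset
  exists even when \<open>S\<close> is infinite; a vector of \<open>S\<close> outside its span could
  be adjoined, against maximality. This replaces the infinitely many columns of \<open>R\<close> by
  finitely many.\<close>

lemma obtain_maximal_lin_indpt:
  assumes "S \<subseteq> carrier_vec n"
  obtains T where "T \<subseteq> S" "finite T" "lin_indpt T" "card T \<le> n" "span T = span S"
proof -
  have bound: "finite T \<and> card T \<le> n" if "T \<subseteq> S \<and> lin_indpt T" for T
    using li_le_dim[OF fin_dim, of T] that assms by (auto simp: dim_is_n)
  have "lin_indpt {}"
    by (simp add: lin_dep_def)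
  then obtain T where T: "finite T" "maximal T (\<lambda>T. T \<subseteq> S \<and> lin_indpt T)"
    using maximal_exists[of "\<lambda>T. T \<subseteq> S \<and> lin_indpt T" n "{}", OF bound] by auto
  then have TS: "T \<subseteq> S" and li: "lin_indpt T"
    by (auto simp: maximal_def)
  have "s \<in> span T" if "s \<in> S" for s
  proof (cases "s \<in> T")
    case True
    then show ?thesis using TS assms by (metis in_own_span subset_trans subsetD)
  next
    case False
    have "\<not> lin_indpt (T \<union> {s})"
    proof
      assume "lin_indpt (T \<union> {s})"
      with T(2) TS \<open>s \<in> S\<close> have "T = T \<union> {s}"
        unfolding maximal_def by (metis Un_insert_right boolean_algebra_cancel.sup0 insert_subset subset_insertI)
      with False show False by blast
    qed
    then show ?thesis
      using lin_dep_iff_in_span[of T s] TS li assms that False by auto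
  qed
  then have "span S \<subseteq> span T"
    by (intro span_is_subset span_is_submodule) (use TS assms in auto)
  then have "span T = span S"
    using span_is_monotone[OF TS] by auto
  with that TS T(1) li bound show thesis by blast
qed

text \<open>The dimension of the span is the size of a maximal independent subset; when that size is
  \<open>n\<close>, the subset is a basis. Both directions of the theorem work with spans, and this
  lemma translates the rank condition.\<close>

lemma rank_of_cols_eq_n_iff:
  assumes S: "S \<subseteq> carrier_vec n"
  shows "rank_of_cols S = n \<longleftrightarrow> span S = carrier_vec n"
proof
  have "vs (carrier_vec n) = V"
    by (simp add: module_vec_def)
  moreover assume "span S = carrier_vec n"
  ultimately show "rank_of_cols S = n"
    unfolding rank_of_cols_def by (simp only: dim_is_n)
next
  assume rank: "rank_of_cols S = n"
  obtain T where T: "T \<subseteq> S" "finite T" "lin_indpt T" "span T = span S"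
    using obtain_maximal_lin_indpt[OF S] by metis
  have "vectorspace.dim class_ring (span_vs T) = card T"
    by (rule dim_span) (use T S in \<open>auto simp: maximal_def\<close>)
  then have "card T = n"
    using rank T by (simp add: rank_of_cols_def)
  then have "basis T"
    using T S by (intro dim_li_is_basis) (auto simp: dim_is_n)
  then show "span S = carrier_vec n"
    using T by (simp add: basis_def)
qed

text \<open>Fewer than \<open>n\<close> independent vectors, taken as rows and padded with zero
  rows, form a singular square matrix. A nonzero kernel vector is orthogonal to these rows and hence
  to their span, which contains \<open>S\<close>.\<close>

lemma orthogonal_vec_exists:
  assumes S: "S \<subseteq> carrier_vec n" and span: "span S \<noteq> carrier_vec n"
  obtains l where "l \<in> carrier_vec n" "l \<noteq> 0\<^sub>v n" "\<And>s. s \<in> S \<Longrightarrow> s \<bullet> l = 0"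
proof -
  obtain T where T: "T \<subseteq> S" "finite T" "lin_indpt T" "card T \<le> n" "span T = span S"
    using obtain_maximal_lin_indpt[OF S] .
  have "card T \<noteq> n"
  proof
    assume "card T = n"
    then have "basis T"
      using T S by (intro dim_li_is_basis) (auto simp: dim_is_n)
    with T span show False by (simp add: basis_def)
  qed
  with T have cT: "card T < n" by simp
  obtain vs where vs: "set vs = T" "length vs = card T"
    using finite_distinct_list[OF T(2)] distinct_card by metis
  define c where "c i = (if i < length vs then vs ! i else 0\<^sub>v n)" for i
  \<comment> \<open>Row \<open>card T\<close> exists because \<open>card T < n\<close>, and
    \<open>c\<close> is already zero there; the explicit case distinction gives the form to which
    \<open>det_row_0\<close> applies.\<close>
  define X where "X = mat\<^sub>r n n (\<lambda>i. if i = card T then 0\<^sub>v n else c i)"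
  have X: "X \<in> carrier_mat n n" by (simp add: X_def)
  have c: "c i \<in> carrier_vec n" for i
    using vs T(1) S nth_mem[of i vs] by (auto simp: c_def)
  have "det X = 0"
    unfolding X_def by (rule det_row_0) (use cT c in auto)
  then obtain l where l: "l \<in> carrier_vec n" "l \<noteq> 0\<^sub>v n" "X *\<^sub>v l = 0\<^sub>v n"
    using det_0_iff_vec_prod_zero_field[OF X] by auto
  have orth: "t \<bullet> l = 0" if t: "t \<in> T" for t
  proof -
    obtain i where i: "i < card T" "vs ! i = t"
      using t vs by (metis in_set_conv_nth)
    have "row X i = c i"
      using i cT c by (simp add: X_def)
    also have "c i = t"
      using i vs by (simp add: c_def)
    finally have "row X i = t" .
    moreover have "(X *\<^sub>v l) $ i = 0" using l i cT by simp
    ultimately show ?thesis using X i cT by simp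
  qed
  \<comment> \<open>The vectors orthogonal to \<open>l\<close> form a subspace, so orthogonality
    passes from \<open>T\<close> to its span.\<close>
  have "submodule class_ring {x \<in> carrier_vec n. x \<bullet> l = 0} V"
    by (rule submodule.intro, rule module_axioms)
      (use l in \<open>auto simp: module_vec_def add_scalar_prod_distrib class_ring_simps\<close>)
  then have "span T \<subseteq> {x \<in> carrier_vec n. x \<bullet> l = 0}"
    by (rule span_is_subset[rotated]) (use orth T S in auto)
  with T in_own_span[of S] S have "s \<bullet> l = 0" if "s \<in> S" for s
    using that by auto
  with that l show thesis by blast
qed

end

section \<open>Matrix-vector identities and words of matrices\<close>

lemma mult_mat_zero_vec: "X \<in> carrier_mat r s \<Longrightarrow> X *\<^sub>v 0\<^sub>v s = 0\<^sub>v r"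
  by (intro eq_vecI) auto

lemma mat_mult_unit_vec:
  fixes X :: "'a::semiring_1 mat"
  assumes "X \<in> carrier_mat r s" "j < s"
  shows "X *\<^sub>v unit_vec s j = col X j"
  by (intro eq_vecI) (use assms in auto)

lemma smult_zero_vec': "(c :: 'a :: mult_zero) \<cdot>\<^sub>v 0\<^sub>v r = 0\<^sub>v r"
  by (intro eq_vecI) auto

lemma word_mat_carrier:
  "Ws \<in> lists (carrier_mat n n) \<Longrightarrow> word_mat n Ws \<in> carrier_mat n n"
  by (induction Ws) (auto simp: word_mat_def)

lemma word_mat_Cons: "word_mat n (W # Ws) = W * word_mat n Ws"
  by (simp add: word_mat_def)

section \<open>White noise and square integrable functions of its past\<close>

locale white_noise = prob_space P for P :: "'a measure" +
  fixes w :: "nat \<Rightarrow> 'a \<Rightarrow> real"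
  assumes indep: "indep_vars (\<lambda>_. borel) w UNIV"
    and sq_integrable: "\<And>k. integrable P (\<lambda>\<omega>. (w k \<omega>)\<^sup>2)"
    and mean_zero: "\<And>k. expectation (w k) = 0"
    and variance_one: "\<And>k. variance (w k) = 1"
begin

text \<open>The scalars admissible at time \<open>k\<close>: they depend only on the noise strictly
  before \<open>k\<close> and are therefore independent of \<open>w k\<close>.\<close>

definition L2 :: "nat \<Rightarrow> ('a \<Rightarrow> real) set" where
  "L2 k = {f \<in> borel_measurable (\<F> P w (int k - 1)). integrable P (\<lambda>\<omega>. (f \<omega>)\<^sup>2)}"

lemma noise_measurable [measurable]: "w k \<in> borel_measurable P"
  using indep by (auto simp: indep_vars_def)

lemma space_F [simp]: "space (\<F> P w k) = space P"
  by (simp add: \<F>_def space_measure_of_conv)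

lemma sets_F:
  "sets (\<F> P w k) = sigma_sets (space P) {w j -` S \<inter> space P | j S. int j \<le> k \<and> S \<in> sets borel}"
  unfolding \<F>_def by (rule sets_measure_of) auto

lemma sets_F_mono: "k \<le> l \<Longrightarrow> sets (\<F> P w k) \<subseteq> sets (\<F> P w l)"
  unfolding sets_F by (rule sigma_sets_mono') force

lemma sets_F_subset: "sets (\<F> P w k) \<subseteq> sets P"
  unfolding sets_F by (rule sets.sigma_sets_subset) auto

lemma measurable_F_mono:
  "f \<in> borel_measurable (\<F> P w k) \<Longrightarrow> k \<le> l \<Longrightarrow> f \<in> borel_measurable (\<F> P w l)"
  using sets_F_mono[of k l] by (auto simp: measurable_def)

lemma noise_adapted: "w k \<in> borel_measurable (\<F> P w (int k))"
  by (rule measurableI) (auto simp: sets_F)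

lemma L2_measurable: "f \<in> L2 k \<Longrightarrow> f \<in> borel_measurable P"
  using sets_F_subset by (auto simp: L2_def measurable_def)

text \<open>\<open>\<F> P w (int k - 1)\<close> is generated by the noises before time
  \<open>k\<close>, and independence of a family passes to the sigma-algebras generated by disjoint
  blocks of it. Every event determined by \<open>f\<close> lies in the sigma-algebra of the past
  block.\<close>

lemma indep_past:
  assumes "f \<in> borel_measurable (\<F> P w (int k - 1))"
  shows "indep_var borel f borel (w k)"
proof -
  let ?E = "\<lambda>i. {w i -` A \<inter> space P | A. A \<in> sets borel}"
  \<comment> \<open>\<open>True\<close> selects the past, \<open>False\<close> the single time
    \<open>k\<close>.\<close>
  let ?I = "case_bool {..<k} {k}"
  \<comment> \<open>For \<open>k = 0\<close> both sides are empty, in accordance with the trivial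
    sigma-algebra at time -1.\<close>
  have past: "{w j -` S \<inter> space P | j S. int j \<le> int k - 1 \<and> S \<in> sets borel} = (\<Union>i<k. ?E i)"
    by force
  have "indep_sets ?E UNIV"
    using indep by (simp add: indep_vars_def2)
  then have "indep_sets (\<lambda>b. sigma_sets (space P) (\<Union>i\<in>?I b. ?E i)) UNIV"
  proof (intro indep_sets_collect_sigma)
    show "indep_sets ?E (\<Union>b. ?I b)" if "indep_sets ?E UNIV"
      using that by (rule indep_sets_mono_index[rotated]) simp
    show "Int_stable (?E i)" for i
      by (auto simp: Int_stable_def) (metis sets.Int vimage_Int Int_assoc Int_commute Int_absorb)
    show "disjoint_family_on ?I UNIV"
      by (auto simp: disjoint_family_on_def split: bool.splits)
  qed
  then have "indep_sets (case_bool (sigma_sets (space P) {f -` A \<inter> space P | A. A \<in> sets borel})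
      (sigma_sets (space P) {w k -` A \<inter> space P | A. A \<in> sets borel})) UNIV"
  proof (rule indep_sets_mono_sets)
    fix b :: bool
    have "{f -` A \<inter> space P | A. A \<in> sets borel} \<subseteq> sets (\<F> P w (int k - 1))"
      using assms by (auto simp: measurable_def)
    then have "sigma_sets (space P) {f -` A \<inter> space P | A. A \<in> sets borel} \<subseteq> sets (\<F> P w (int k - 1))"
      using sets.sigma_sets_subset[of _ "\<F> P w (int k - 1)"] by simp
    then show "case_bool (sigma_sets (space P) {f -` A \<inter> space P | A. A \<in> sets borel})
        (sigma_sets (space P) {w k -` A \<inter> space P | A. A \<in> sets borel}) b
      \<subseteq> sigma_sets (space P) (\<Union>i\<in>?I b. ?E i)"
      unfolding sets_F past by (cases b) simp_all
  qed
  moreover have "f \<in> borel_measurable P"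
    using assms sets_F_subset by (auto simp: measurable_def)
  ultimately show ?thesis
    by (simp add: indep_var_eq indep_set_def)
qed

lemma second_moment_one: "expectation (\<lambda>\<omega>. (w k \<omega>)\<^sup>2) = 1"
  using variance_one[of k] by (simp add: mean_zero)

lemma noise_integrable: "integrable P (w k)"
  by (rule square_integrable_imp_integrable) (use sq_integrable in auto)

lemma integrable_mult_L2:
  assumes "f \<in> L2 k" "g \<in> L2 k"
  shows "integrable P (\<lambda>\<omega>. f \<omega> * g \<omega>)"
proof (rule Bochner_Integration.integrable_bound)
  show "integrable P (\<lambda>\<omega>. (f \<omega>)\<^sup>2 + (g \<omega>)\<^sup>2)"
    using assms by (auto simp: L2_def)
  have "\<bar>a * b\<bar> \<le> a\<^sup>2 + b\<^sup>2" for a b :: real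
  proof -
    have "2 * (\<bar>a\<bar> * \<bar>b\<bar>) \<le> a\<^sup>2 + b\<^sup>2"
      using sum_squares_bound[of "\<bar>a\<bar>" "\<bar>b\<bar>"] by (simp add: mult.assoc)
    moreover have "0 \<le> \<bar>a\<bar> * \<bar>b\<bar>" by simp
    ultimately show ?thesis unfolding abs_mult by linarith
  qed
  then show "AE \<omega> in P. norm (f \<omega> * g \<omega>) \<le> norm ((f \<omega>)\<^sup>2 + (g \<omega>)\<^sup>2)"
    by simp
  show "(\<lambda>\<omega>. f \<omega> * g \<omega>) \<in> borel_measurable P"
    using assms[THEN L2_measurable] by measurable
qed

lemma L2_add:
  assumes "f \<in> L2 k" "g \<in> L2 k"
  shows "(\<lambda>\<omega>. f \<omega> + g \<omega>) \<in> L2 k"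
proof -
  have "integrable P (\<lambda>\<omega>. (f \<omega>)\<^sup>2 + (g \<omega>)\<^sup>2 + 2 * (f \<omega> * g \<omega>))"
    using assms integrable_mult_L2[OF assms] by (auto simp: L2_def)
  then show ?thesis
    using assms by (auto simp: L2_def power2_sum mult.assoc)
qed

lemma L2_cmult: "f \<in> L2 k \<Longrightarrow> (\<lambda>\<omega>. c * f \<omega>) \<in> L2 k"
  by (auto simp: L2_def power_mult_distrib)

lemma L2_const: "(\<lambda>\<omega>. c) \<in> L2 k"
  by (simp add: L2_def)

lemma L2_sum: "(\<And>i. i \<in> I \<Longrightarrow> f i \<in> L2 k) \<Longrightarrow> (\<lambda>\<omega>. \<Sum>i\<in>I. f i \<omega>) \<in> L2 k"
  by (induction I rule: infinite_finite_induct) (auto intro: L2_const L2_add)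

lemma L2_mono: "f \<in> L2 k \<Longrightarrow> k \<le> l \<Longrightarrow> f \<in> L2 l"
  by (auto simp: L2_def intro: measurable_F_mono)

text \<open>The squares of \<open>f\<close> and \<open>w k\<close> are independent and the latter
  has expectation one, so multiplication by \<open>w k\<close> preserves the norm of
  \<open>L2 k\<close>.\<close>

lemma
  assumes "f \<in> L2 k"
  shows integrable_square_mult_noise: "integrable P (\<lambda>\<omega>. (f \<omega>)\<^sup>2 * (w k \<omega>)\<^sup>2)"
    and expectation_square_mult_noise:
      "expectation (\<lambda>\<omega>. (f \<omega>)\<^sup>2 * (w k \<omega>)\<^sup>2) = expectation (\<lambda>\<omega>. (f \<omega>)\<^sup>2)"
proof -
  have "indep_var borel ((\<lambda>x. x\<^sup>2) \<circ> f) borel ((\<lambda>x. x\<^sup>2) \<circ> w k)"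
    by (rule indep_var_compose[OF indep_past]) (use assms in \<open>auto simp: L2_def\<close>)
  then have ind: "indep_var borel (\<lambda>\<omega>. (f \<omega>)\<^sup>2) borel (\<lambda>\<omega>. (w k \<omega>)\<^sup>2)"
    by (simp add: comp_def)
  have int: "integrable P (\<lambda>\<omega>. (f \<omega>)\<^sup>2)"
    using assms by (simp add: L2_def)
  show "integrable P (\<lambda>\<omega>. (f \<omega>)\<^sup>2 * (w k \<omega>)\<^sup>2)"
    by (rule indep_var_integrable[OF ind int sq_integrable])
  show "expectation (\<lambda>\<omega>. (f \<omega>)\<^sup>2 * (w k \<omega>)\<^sup>2) = expectation (\<lambda>\<omega>. (f \<omega>)\<^sup>2)"
    using indep_var_lebesgue_integral[OF ind int sq_integrable] by (simp add: second_moment_one)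
qed

text \<open>The product is measurable with respect to \<open>\<F> P w (int k)\<close>, the
  sigma-algebra behind \<open>L2 (Suc k)\<close>: each factor of noise moves the time index up by
  one.\<close>

lemma L2_mult_noise:
  assumes "f \<in> L2 k"
  shows "(\<lambda>\<omega>. w k \<omega> * f \<omega>) \<in> L2 (Suc k)"
proof -
  have "f \<in> borel_measurable (\<F> P w (int k))"
    using L2_mono[OF assms, of "Suc k"] by (simp add: L2_def)
  moreover note noise_adapted[of k]
  ultimately show ?thesis
    using integrable_square_mult_noise[OF assms]
    by (simp add: L2_def power_mult_distrib mult.commute)
qed

text \<open>The square of the sum has expectation zero. Its mixed term vanishes, since
  \<open>w k\<close> has mean zero and is independent of \<open>f * g\<close>; what remains is the
  sum of the second moments of \<open>f\<close> and \<open>g\<close>, both nonnegative.\<close>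

lemma noise_combination_zero:
  assumes f: "f \<in> L2 k" and g: "g \<in> L2 k"
    and zero: "AE \<omega> in P. f \<omega> + w k \<omega> * g \<omega> = 0"
  shows "AE \<omega> in P. f \<omega> = 0" "AE \<omega> in P. g \<omega> = 0"
proof -
  note [measurable] = L2_measurable[OF f] L2_measurable[OF g]
  have fg: "integrable P (\<lambda>\<omega>. f \<omega> * g \<omega>)"
    by (rule integrable_mult_L2[OF f g])
  \<comment> \<open>The product \<open>f * g\<close> is known only to be integrable, which suffices
    here: \<open>indep_past\<close> asks for measurability alone.\<close>
  have ind: "indep_var borel (\<lambda>\<omega>. f \<omega> * g \<omega>) borel (w k)"
    by (rule indep_past) (use f g in \<open>auto simp: L2_def\<close>)
  have fgw: "integrable P (\<lambda>\<omega>. f \<omega> * g \<omega> * w k \<omega>)" "expectation (\<lambda>\<omega>. f \<omega> * g \<omega> * w k \<omega>) = 0"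
    using indep_var_integrable[OF ind fg noise_integrable]
      indep_var_lebesgue_integral[OF ind fg noise_integrable] by (simp_all add: mean_zero)
  have f2: "integrable P (\<lambda>\<omega>. (f \<omega>)\<^sup>2)" and g2: "integrable P (\<lambda>\<omega>. (g \<omega>)\<^sup>2)"
    using f g by (auto simp: L2_def)
  have "0 = expectation (\<lambda>\<omega>. (f \<omega> + w k \<omega> * g \<omega>)\<^sup>2)"
    by (rule sym, rule integral_eq_zero_AE) (use zero in auto)
  also have "\<dots> = expectation (\<lambda>\<omega>. (f \<omega>)\<^sup>2 + (2 * (f \<omega> * g \<omega> * w k \<omega>) + (g \<omega>)\<^sup>2 * (w k \<omega>)\<^sup>2))"
    by (simp add: power2_eq_square algebra_simps)
  also have "\<dots> = expectation (\<lambda>\<omega>. (f \<omega>)\<^sup>2) + expectation (\<lambda>\<omega>. (g \<omega>)\<^sup>2)"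
    using f2 fgw integrable_square_mult_noise[OF g]
    by (simp add: expectation_square_mult_noise[OF g])
  finally have "expectation (\<lambda>\<omega>. (f \<omega>)\<^sup>2) = 0" "expectation (\<lambda>\<omega>. (g \<omega>)\<^sup>2) = 0"
    using Bochner_Integration.integral_nonneg[of P "\<lambda>\<omega>. (f \<omega>)\<^sup>2"]
      Bochner_Integration.integral_nonneg[of P "\<lambda>\<omega>. (g \<omega>)\<^sup>2"] by (auto simp: add_nonneg_eq_0_iff)
  then show "AE \<omega> in P. f \<omega> = 0" "AE \<omega> in P. g \<omega> = 0"
    using integral_nonneg_eq_0_iff_AE[OF f2] integral_nonneg_eq_0_iff_AE[OF g2] by auto
qed

lemma L2_cong: "(\<And>\<omega>. \<omega> \<in> space P \<Longrightarrow> f \<omega> = g \<omega>) \<Longrightarrow> f \<in> L2 k \<longleftrightarrow> g \<in> L2 k"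
  unfolding L2_def mem_Collect_eq
  by (intro arg_cong2[where f = "(\<and>)"] measurable_cong Bochner_Integration.integrable_cong) auto

lemma L2_diff: "f \<in> L2 k \<Longrightarrow> g \<in> L2 k \<Longrightarrow> (\<lambda>\<omega>. f \<omega> - g \<omega>) \<in> L2 k"
  using L2_add[of f k "\<lambda>\<omega>. - 1 * g \<omega>"] L2_cmult[of g k "- 1"] by simp

section \<open>Square integrable random vectors\<close>

text \<open>A single time slice of \<open>l2_adapted\<close>, so that arguments about one step need
  no horizon.\<close>

definition L2_vec :: "nat \<Rightarrow> nat \<Rightarrow> ('a \<Rightarrow> real vec) set" where
  "L2_vec s k = {y. (\<forall>\<omega>\<in>space P. y \<omega> \<in> carrier_vec s) \<and> (\<forall>i<s. (\<lambda>\<omega>. y \<omega> $ i) \<in> L2 k)}"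

lemma l2_adapted_iff: "y \<in> l2_adapted P w N s \<longleftrightarrow> (\<forall>k\<le>N. y k \<in> L2_vec s k)"
  by (auto simp: l2_adapted_def L2_vec_def L2_def)

lemma L2_vec_carrier: "y \<in> L2_vec s k \<Longrightarrow> \<omega> \<in> space P \<Longrightarrow> y \<omega> \<in> carrier_vec s"
  by (simp add: L2_vec_def)

lemma L2_vecI:
  assumes "\<And>\<omega>. \<omega> \<in> space P \<Longrightarrow> y \<omega> \<in> carrier_vec s"
    and "\<And>i. i < s \<Longrightarrow> f i \<in> L2 k"
    and "\<And>i \<omega>. i < s \<Longrightarrow> \<omega> \<in> space P \<Longrightarrow> y \<omega> $ i = f i \<omega>"
  shows "y \<in> L2_vec s k"
proof -
  have "(\<lambda>\<omega>. y \<omega> $ i) \<in> L2 k" if "i < s" for i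
    using L2_cong[of "\<lambda>\<omega>. y \<omega> $ i" "f i" k] assms that by simp
  then show ?thesis
    using assms(1) by (simp add: L2_vec_def)
qed

lemma L2_scalar_prod:
  assumes y: "y \<in> L2_vec s k"
  shows "(\<lambda>\<omega>. l \<bullet> y \<omega>) \<in> L2 k"
proof -
  have "(\<lambda>\<omega>. \<Sum>i\<in>{0..<s}. l $ i * y \<omega> $ i) \<in> L2 k"
    using y by (intro L2_sum L2_cmult) (simp add: L2_vec_def)
  then show ?thesis
    by (rule iffD1[OF L2_cong, rotated]) (use L2_vec_carrier[OF y, THEN carrier_vecD] in \<open>simp add: scalar_prod_def\<close>)
qed

lemma L2_vec_add:
  assumes "y \<in> L2_vec s k" "z \<in> L2_vec s k"
  shows "(\<lambda>\<omega>. y \<omega> + z \<omega>) \<in> L2_vec s k"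
  by (rule L2_vecI[where f = "\<lambda>i \<omega>. y \<omega> $ i + z \<omega> $ i"])
    (use assms in \<open>auto simp: L2_vec_def intro: L2_add\<close>)

lemma L2_vec_smult:
  assumes "f \<in> L2 k" "u \<in> carrier_vec s"
  shows "(\<lambda>\<omega>. f \<omega> \<cdot>\<^sub>v u) \<in> L2_vec s k"
  by (rule L2_vecI[where f = "\<lambda>i \<omega>. u $ i * f \<omega>"])
    (use assms in \<open>auto intro: L2_cmult\<close>)

lemma L2_vec_zero: "(\<lambda>\<omega>. 0\<^sub>v s) \<in> L2_vec s k"
  by (rule L2_vecI[where f = "\<lambda>i \<omega>. 0"]) (auto intro: L2_const)

end

section \<open>The backward system, with \<open>C'\<close> a left inverse of
  \<open>C\<close>\<close>

locale backward_system = white_noise P w for P :: "'a measure" and w +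
  fixes n p :: nat and C Cbar D C' :: "real mat"
  assumes C [simp]: "C \<in> carrier_mat n n" and Cbar [simp]: "Cbar \<in> carrier_mat n n"
    and D [simp]: "D \<in> carrier_mat n p"
    and C' [simp]: "C' \<in> carrier_mat n n" and C'_C: "C' * C = 1\<^sub>m n"
begin

lemmas system_dims [simp] = carrier_matD[OF C] carrier_matD[OF Cbar] carrier_matD[OF D] carrier_matD[OF C']
lemmas system_mult_closed [simp] = mult_mat_vec_carrier[OF C] mult_mat_vec_carrier[OF Cbar]
  mult_mat_vec_carrier[OF D] mult_mat_vec_carrier[OF C']

definition backward :: "nat \<Rightarrow> 'a \<Rightarrow> real vec \<Rightarrow> real vec \<Rightarrow> real vec \<Rightarrow> real vec" where
  "backward k \<omega> x z v = C *\<^sub>v x + Cbar *\<^sub>v z + D *\<^sub>v v - C *\<^sub>v (w k \<omega> \<cdot>\<^sub>v z)"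

abbreviation words :: "real mat list set" where
  "words \<equiv> lists {C, Cbar}"

lemma words_carrier [simp]: "Ws \<in> words \<Longrightarrow> word_mat n Ws \<in> carrier_mat n n"
  by (rule word_mat_carrier) (use C Cbar in \<open>auto simp: in_lists_conv_set\<close>)

lemma R_cols_carrier: "R_cols n C Cbar D \<subseteq> carrier_vec n"
proof -
  have "word_mat n Ws * D \<in> carrier_mat n p" if "Ws \<in> words" for Ws
    by (rule mult_carrier_mat[OF words_carrier[OF that] D])
  then show ?thesis
    unfolding R_cols_def using cols_dim by (metis (no_types, lifting) UN_least carrier_matD(1))
qed

section \<open>Sufficiency: steering states to zero\<close>

text \<open>The processes run over all times from \<open>k\<close> on and the state stays zero from
  some deterministic time \<open>K\<close> on, so solutions with different horizons can be added.
  The equation is required at every sample point, which avoids null sets in the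
  construction.\<close>

definition steerable :: "nat \<Rightarrow> ('a \<Rightarrow> real vec) \<Rightarrow> bool" where
  "steerable k Y \<longleftrightarrow> (\<exists>v x z K. x k = Y \<and>
     (\<forall>j\<ge>k. v j \<in> L2_vec p j \<and> x j \<in> L2_vec n j \<and> z j \<in> L2_vec n j \<and>
       (\<forall>\<omega>\<in>space P. x j \<omega> = backward j \<omega> (x (Suc j) \<omega>) (z j \<omega>) (v j \<omega>))) \<and>
     (\<forall>j\<ge>K. \<forall>\<omega>\<in>space P. x j \<omega> = 0\<^sub>v n))"

lemma backward_zero: "backward k \<omega> (0\<^sub>v n) (0\<^sub>v n) (0\<^sub>v p) = 0\<^sub>v n"
  by (simp add: backward_def smult_zero_vec' mult_mat_zero_vec[of _ n n] mult_mat_zero_vec[of _ n p])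

lemma backward_add:
  assumes "x \<in> carrier_vec n" "x' \<in> carrier_vec n" "z \<in> carrier_vec n" "z' \<in> carrier_vec n"
    "v \<in> carrier_vec p" "v' \<in> carrier_vec p"
  shows "backward k \<omega> (x + x') (z + z') (v + v') = backward k \<omega> x z v + backward k \<omega> x' z' v'"
proof -
  have regroup: "(a + a') + (b + b') + (c + c') - (d + d') = (a + b + c - d) + (a' + b' + c' - d')"
    if "a \<in> carrier_vec n" "a' \<in> carrier_vec n" "b \<in> carrier_vec n" "b' \<in> carrier_vec n"
      "c \<in> carrier_vec n" "c' \<in> carrier_vec n" "d \<in> carrier_vec n" "d' \<in> carrier_vec n"
    for a a' b b' c c' d d' :: "real vec"
    by (intro eq_vecI) (use that in auto)
  have mult: "X *\<^sub>v (y + y') = X *\<^sub>v y + X *\<^sub>v y'"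
    if "X \<in> carrier_mat r s" "y \<in> carrier_vec s" "y' \<in> carrier_vec s" for X :: "real mat" and y y' r s
    using that by (rule mult_add_distrib_mat_vec)
  have "w k \<omega> \<cdot>\<^sub>v (z + z') = w k \<omega> \<cdot>\<^sub>v z + w k \<omega> \<cdot>\<^sub>v z'"
    using assms by (intro smult_add_distrib_vec)
  then have "backward k \<omega> (x + x') (z + z') (v + v') =
    (C *\<^sub>v x + C *\<^sub>v x') + (Cbar *\<^sub>v z + Cbar *\<^sub>v z') + (D *\<^sub>v v + D *\<^sub>v v')
      - (C *\<^sub>v (w k \<omega> \<cdot>\<^sub>v z) + C *\<^sub>v (w k \<omega> \<cdot>\<^sub>v z'))"
    using assms mult[OF C] mult[OF Cbar] mult[OF D] by (simp add: backward_def)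
  also have "\<dots> = backward k \<omega> x z v + backward k \<omega> x' z' v'"
    unfolding backward_def
    by (rule regroup) (use assms in simp_all)
  finally show ?thesis .
qed

lemma steerable_zero: "steerable k (\<lambda>\<omega>. 0\<^sub>v n)"
  unfolding steerable_def
  by (rule exI[of _ "\<lambda>_ _. 0\<^sub>v p"], rule exI[of _ "\<lambda>_ _. 0\<^sub>v n"], rule exI[of _ "\<lambda>_ _. 0\<^sub>v n"])
    (auto simp: L2_vec_zero backward_zero)

text \<open>Prepends one step: the given solution from time \<open>Suc k\<close> on is kept, and its
  values at time \<open>k\<close> are overwritten by \<open>V\<close>, \<open>Y\<close> and
  \<open>Z\<close>.\<close>

lemma steerable_step:
  assumes "steerable (Suc k) Y'" and "Y \<in> L2_vec n k" "Z \<in> L2_vec n k" "V \<in> L2_vec p k"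
    and "\<And>\<omega>. \<omega> \<in> space P \<Longrightarrow> Y \<omega> = backward k \<omega> (Y' \<omega>) (Z \<omega>) (V \<omega>)"
  shows "steerable k Y"
proof -
  from assms(1) obtain v x z K where Y': "x (Suc k) = Y'"
    and sys: "\<And>j. Suc k \<le> j \<Longrightarrow> v j \<in> L2_vec p j \<and> x j \<in> L2_vec n j \<and> z j \<in> L2_vec n j \<and>
       (\<forall>\<omega>\<in>space P. x j \<omega> = backward j \<omega> (x (Suc j) \<omega>) (z j \<omega>) (v j \<omega>))"
    and null: "\<And>j \<omega>. K \<le> j \<Longrightarrow> \<omega> \<in> space P \<Longrightarrow> x j \<omega> = 0\<^sub>v n"
    unfolding steerable_def by blast
  show ?thesis
    unfolding steerable_def
  proof (rule exI[of _ "v(k := V)"], rule exI[of _ "x(k := Y)"], rule exI[of _ "z(k := Z)"],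
      \<comment> \<open>The maximum excludes time \<open>k\<close>, where the overwritten state may
        be nonzero.\<close>
      rule exI[of _ "max K (Suc k)"], intro conjI allI impI)
    show "(x(k := Y)) k = Y" by simp
    fix j assume "k \<le> j"
    then have "j = k \<or> Suc k \<le> j" by auto
    then show "(v(k := V)) j \<in> L2_vec p j" "(x(k := Y)) j \<in> L2_vec n j" "(z(k := Z)) j \<in> L2_vec n j"
      "\<forall>\<omega>\<in>space P. (x(k := Y)) j \<omega> =
        backward j \<omega> ((x(k := Y)) (Suc j) \<omega>) ((z(k := Z)) j \<omega>) ((v(k := V)) j \<omega>)"
      using sys[of j] assms Y' by auto
  next
    fix j assume "max K (Suc k) \<le> j"
    then show "\<forall>\<omega>\<in>space P. (x(k := Y)) j \<omega> = 0\<^sub>v n"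
      using null by auto
  qed
qed

text \<open>Superposition: the equation is linear, and both states vanish from the later of the two
  null times on.\<close>

lemma steerable_add:
  assumes "steerable k Y" "steerable k Y'"
  shows "steerable k (\<lambda>\<omega>. Y \<omega> + Y' \<omega>)"
proof -
  obtain v x z K where Y: "x k = Y"
    and sys: "\<And>j. k \<le> j \<Longrightarrow> v j \<in> L2_vec p j" "\<And>j. k \<le> j \<Longrightarrow> x j \<in> L2_vec n j"
      "\<And>j. k \<le> j \<Longrightarrow> z j \<in> L2_vec n j"
      "\<And>j \<omega>. k \<le> j \<Longrightarrow> \<omega> \<in> space P \<Longrightarrow> x j \<omega> = backward j \<omega> (x (Suc j) \<omega>) (z j \<omega>) (v j \<omega>)"
    and null: "\<And>j \<omega>. K \<le> j \<Longrightarrow> \<omega> \<in> space P \<Longrightarrow> x j \<omega> = 0\<^sub>v n"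
    using assms(1) unfolding steerable_def by blast
  obtain v' x' z' K' where Y': "x' k = Y'"
    and sys': "\<And>j. k \<le> j \<Longrightarrow> v' j \<in> L2_vec p j" "\<And>j. k \<le> j \<Longrightarrow> x' j \<in> L2_vec n j"
      "\<And>j. k \<le> j \<Longrightarrow> z' j \<in> L2_vec n j"
      "\<And>j \<omega>. k \<le> j \<Longrightarrow> \<omega> \<in> space P \<Longrightarrow> x' j \<omega> = backward j \<omega> (x' (Suc j) \<omega>) (z' j \<omega>) (v' j \<omega>)"
    and null': "\<And>j \<omega>. K' \<le> j \<Longrightarrow> \<omega> \<in> space P \<Longrightarrow> x' j \<omega> = 0\<^sub>v n"
    using assms(2) unfolding steerable_def by blast
  show ?thesis
    unfolding steerable_def
  proof (rule exI[of _ "\<lambda>j \<omega>. v j \<omega> + v' j \<omega>"], rule exI[of _ "\<lambda>j \<omega>. x j \<omega> + x' j \<omega>"],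
      rule exI[of _ "\<lambda>j \<omega>. z j \<omega> + z' j \<omega>"], rule exI[of _ "max K K'"],
      intro conjI allI impI ballI)
    show "(\<lambda>\<omega>. x k \<omega> + x' k \<omega>) = (\<lambda>\<omega>. Y \<omega> + Y' \<omega>)"
      using Y Y' by simp
    fix j assume j: "k \<le> j"
    then show "(\<lambda>\<omega>. v j \<omega> + v' j \<omega>) \<in> L2_vec p j" "(\<lambda>\<omega>. x j \<omega> + x' j \<omega>) \<in> L2_vec n j"
      "(\<lambda>\<omega>. z j \<omega> + z' j \<omega>) \<in> L2_vec n j"
      using sys sys' by (auto intro: L2_vec_add)
    fix \<omega> assume \<omega>: "\<omega> \<in> space P"
    have "backward j \<omega> (x (Suc j) \<omega> + x' (Suc j) \<omega>) (z j \<omega> + z' j \<omega>) (v j \<omega> + v' j \<omega>) =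
        backward j \<omega> (x (Suc j) \<omega>) (z j \<omega>) (v j \<omega>) + backward j \<omega> (x' (Suc j) \<omega>) (z' j \<omega>) (v' j \<omega>)"
      using j
      by (intro backward_add L2_vec_carrier[OF sys(1) \<omega>] L2_vec_carrier[OF sys(2) \<omega>]
          L2_vec_carrier[OF sys(3) \<omega>] L2_vec_carrier[OF sys'(1) \<omega>] L2_vec_carrier[OF sys'(2) \<omega>]
          L2_vec_carrier[OF sys'(3) \<omega>]) simp_all
    then show "x j \<omega> + x' j \<omega> =
        backward j \<omega> (x (Suc j) \<omega> + x' (Suc j) \<omega>) (z j \<omega> + z' j \<omega>) (v j \<omega> + v' j \<omega>)"
      using sys(4)[OF j \<omega>] sys'(4)[OF j \<omega>] by simp
  next
    fix j \<omega> assume "max K K' \<le> j" "\<omega> \<in> space P"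
    then show "x j \<omega> + x' j \<omega> = 0\<^sub>v n"
      using null null' by simp
  qed
qed

text \<open>
  A letter \<open>C\<close> is a step with \<open>z k = 0\<close>; a letter \<open>Cbar\<close> is a step with
  \<open>x (k + 1) = w k * z k\<close>, for which the two terms with \<open>C\<close> cancel. Since the latter multiplies
  the state by the noise, the induction needs a random factor \<open>f\<close>.
\<close>

lemma steerable_word:
  assumes "Ws \<in> words" "u \<in> carrier_vec p" "f \<in> L2 k"
  shows "steerable k (\<lambda>\<omega>. f \<omega> \<cdot>\<^sub>v (word_mat n Ws *\<^sub>v (D *\<^sub>v u)))"
  using assms(1,3)
proof (induction Ws arbitrary: k f rule: lists.induct)
  case Nil
  have "D *\<^sub>v u \<in> carrier_vec n"
    using assms(2) by simp
  with Nil show ?case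
    using assms(2)
    \<comment> \<open>For the empty word the state is \<open>f\<close> times \<open>D u\<close>, and
      the control \<open>f\<close> times \<open>u\<close> alone accounts for it, so the next state
      can be zero.\<close>
    by (intro steerable_step[OF steerable_zero, of _ k "\<lambda>\<omega>. 0\<^sub>v n" "\<lambda>\<omega>. f \<omega> \<cdot>\<^sub>v u"])
      (auto simp: L2_vec_zero L2_vec_smult backward_def word_mat_def mult_mat_zero_vec[of _ n n]
        mult_mat_vec[OF D])
next
  case (Cons W Ws)
  define y where "y = word_mat n Ws *\<^sub>v (D *\<^sub>v u)"
  have Ws: "Ws \<in> words" using Cons by simp
  have y: "y \<in> carrier_vec n"
    using words_carrier[OF Ws] assms(2) by (simp add: y_def)
  have W: "W \<in> carrier_mat n n"
    using Cons(1) by auto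
  have word: "word_mat n (W # Ws) *\<^sub>v (D *\<^sub>v u) = W *\<^sub>v y"
    unfolding word_mat_Cons y_def
    by (rule assoc_mult_mat_vec[OF W words_carrier[OF Ws]]) (use assms(2) in simp)
  have Wy: "(\<lambda>\<omega>. f \<omega> \<cdot>\<^sub>v (W *\<^sub>v y)) \<in> L2_vec n k" "(\<lambda>\<omega>. f \<omega> \<cdot>\<^sub>v y) \<in> L2_vec n k"
    using Cons.prems W y by (auto intro: L2_vec_smult)
  consider "W = C" | "W = Cbar"
    using Cons(1) by auto
  then show ?case
  proof cases
    case 1
    have "steerable (Suc k) (\<lambda>\<omega>. f \<omega> \<cdot>\<^sub>v y)"
      unfolding y_def by (rule Cons.IH) (use Cons.prems L2_mono in auto)
    then show ?thesis
      unfolding word using Wy(1) 1 y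
      by (elim steerable_step[where Z = "\<lambda>\<omega>. 0\<^sub>v n" and V = "\<lambda>\<omega>. 0\<^sub>v p"])
        (auto simp: L2_vec_zero backward_def smult_zero_vec' mult_mat_zero_vec[of _ n n] mult_mat_zero_vec[of _ n p]
          mult_mat_vec[OF C])
  next
    case 2
    have "steerable (Suc k) (\<lambda>\<omega>. (w k \<omega> * f \<omega>) \<cdot>\<^sub>v y)"
      unfolding y_def by (rule Cons.IH) (rule L2_mult_noise[OF Cons.prems])
    moreover have "f \<omega> \<cdot>\<^sub>v (W *\<^sub>v y) = backward k \<omega> ((w k \<omega> * f \<omega>) \<cdot>\<^sub>v y) (f \<omega> \<cdot>\<^sub>v y) (0\<^sub>v p)" for \<omega>
    proof -
      define a where "a = C *\<^sub>v ((w k \<omega> * f \<omega>) \<cdot>\<^sub>v y)"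
      define b where "b = f \<omega> \<cdot>\<^sub>v (Cbar *\<^sub>v y)"
      have ab: "a \<in> carrier_vec n" "b \<in> carrier_vec n"
        using y C Cbar by (auto simp: a_def b_def)
      have "backward k \<omega> ((w k \<omega> * f \<omega>) \<cdot>\<^sub>v y) (f \<omega> \<cdot>\<^sub>v y) (0\<^sub>v p) = a + b + 0\<^sub>v n - a"
        using y by (simp add: backward_def a_def b_def smult_smult_assoc mult_mat_vec[OF Cbar]
            mult_mat_zero_vec[of _ n p])
      also have "\<dots> = b"
        using ab by (intro eq_vecI) auto
      finally show ?thesis
        using 2 by (simp add: b_def)
    qed
    ultimately show ?thesis
      unfolding word using Wy
      by (elim steerable_step[where Z = "\<lambda>\<omega>. f \<omega> \<cdot>\<^sub>v y" and V = "\<lambda>\<omega>. 0\<^sub>v p"])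
        (auto simp: L2_vec_zero)
  qed
qed

interpretation V: vec_space "TYPE(real)" n .

text \<open>The vectors all of whose multiples by elements of \<open>L2 k\<close> are steerable form
  a subspace, and this subspace contains the columns of \<open>R\<close>.\<close>

lemma steerable_span:
  assumes "y \<in> V.span (R_cols n C Cbar D)" "f \<in> L2 k"
  shows "steerable k (\<lambda>\<omega>. f \<omega> \<cdot>\<^sub>v y)"
proof -
  \<comment> \<open>Quantifying over \<open>f\<close> inside the set gives closure under scalars: a
    constant \<open>c\<close> is absorbed into the factor.\<close>
  define T where "T = {y \<in> carrier_vec n. \<forall>f\<in>L2 k. steerable k (\<lambda>\<omega>. f \<omega> \<cdot>\<^sub>v y)}"
  have "submodule class_ring T V.V"
  proof (rule submodule.intro, rule V.module_axioms)
    show "T \<subseteq> carrier V.V"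
      by (auto simp: T_def)
    show "x \<oplus>\<^bsub>V.V\<^esub> y \<in> T" if "x \<in> T" "y \<in> T" for x y
    proof -
      have "steerable k (\<lambda>\<omega>. f \<omega> \<cdot>\<^sub>v (x + y))" if "f \<in> L2 k" for f
        using steerable_add[of k "\<lambda>\<omega>. f \<omega> \<cdot>\<^sub>v x" "\<lambda>\<omega>. f \<omega> \<cdot>\<^sub>v y"] \<open>x \<in> T\<close> \<open>y \<in> T\<close> that
        by (simp add: T_def smult_add_distrib_vec[of _ n])
      with that show ?thesis by (simp add: T_def module_vec_def)
    qed
    show "\<zero>\<^bsub>V.V\<^esub> \<in> T"
      by (simp add: T_def module_vec_def steerable_zero)
    show "c \<odot>\<^bsub>V.V\<^esub> x \<in> T" if "c \<in> carrier class_ring" "x \<in> T" for c x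
    proof -
      have "steerable k (\<lambda>\<omega>. f \<omega> \<cdot>\<^sub>v (c \<cdot>\<^sub>v x))" if "f \<in> L2 k" for f
        using L2_cmult[OF that, of c] \<open>x \<in> T\<close>
        by (auto simp: T_def smult_smult_assoc mult.commute)
      with that show ?thesis by (simp add: T_def module_vec_def)
    qed
  qed
  moreover have "R_cols n C Cbar D \<subseteq> T"
  proof
    fix y assume "y \<in> R_cols n C Cbar D"
    then obtain Ws where Ws: "Ws \<in> words" and "y \<in> set (cols (word_mat n Ws * D))"
      by (auto simp: R_cols_def)
    then obtain j where j: "j < p" and "y = col (word_mat n Ws * D) j"
      using D by (auto simp: cols_def)
    \<comment> \<open>A column of a matrix is its value at a unit vector, which exhibits
      \<open>y\<close> as a state handled by \<open>steerable_word\<close>.\<close>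
    then have "y = word_mat n Ws *\<^sub>v (D *\<^sub>v unit_vec p j)"
      using col_mult2[OF words_carrier[OF Ws] D j] by (simp add: mat_mult_unit_vec[OF D j])
    moreover have "y \<in> carrier_vec n"
      using R_cols_carrier \<open>y \<in> R_cols n C Cbar D\<close> by auto
    ultimately show "y \<in> T"
      using steerable_word[OF Ws, of "unit_vec p j"] by (simp add: T_def)
  qed
  ultimately have "V.span (R_cols n C Cbar D) \<subseteq> T"
    by (intro V.span_is_subset)
  with assms show ?thesis by (auto simp: T_def)
qed

lemma exactly_null_controllable_if_span:
  assumes "V.span (R_cols n C Cbar D) = carrier_vec n"
  shows "exactly_null_controllable P w n p C Cbar D"
  unfolding exactly_null_controllable_def
proof (intro ballI impI)
  fix x0 :: "real vec" assume x0: "x0 \<in> carrier_vec n"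
  have "steerable 0 (\<lambda>\<omega>. 1 \<cdot>\<^sub>v x0)"
    by (rule steerable_span) (use assms x0 L2_const in auto)
  then have "steerable 0 (\<lambda>\<omega>. x0)"
    by simp
  then obtain v x z K where Y: "x 0 = (\<lambda>\<omega>. x0)"
    and sys: "\<And>j. v j \<in> L2_vec p j" "\<And>j. x j \<in> L2_vec n j"
      "\<And>j. z j \<in> L2_vec n j"
      "\<And>j \<omega>. \<omega> \<in> space P \<Longrightarrow> x j \<omega> = backward j \<omega> (x (Suc j) \<omega>) (z j \<omega>) (v j \<omega>)"
    and null: "\<And>j \<omega>. K \<le> j \<Longrightarrow> \<omega> \<in> space P \<Longrightarrow> x j \<omega> = 0\<^sub>v n"
    unfolding steerable_def using le0 by blast
  show "\<exists>N>0. \<exists>v \<in> l2_adapted P w N p. \<exists>x \<in> l2_adapted P w (N + 1) n. \<exists>z \<in> l2_adapted P w N n.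
          (\<forall>k\<in>{0..N}. AE \<omega> in P.
             x k \<omega> = C *\<^sub>v x (k + 1) \<omega> + Cbar *\<^sub>v z k \<omega> + D *\<^sub>v v k \<omega>
                     - C *\<^sub>v (w k \<omega> \<cdot>\<^sub>v z k \<omega>)) \<and>
          (AE \<omega> in P. x 0 \<omega> = x0) \<and>
          (AE \<omega> in P. x (N + 1) \<omega> = 0\<^sub>v n)"
  \<comment> \<open>The successor makes the horizon positive even for \<open>K = 0\<close>; the
    final time lies beyond \<open>K\<close>, so the state is zero there.\<close>
  proof (rule exI[of _ "Suc K"], rule conjI[OF zero_less_Suc], rule bexI[of _ v], rule bexI[of _ x],
      rule bexI[of _ z], intro conjI ballI)
    show "AE \<omega> in P. x k \<omega> = C *\<^sub>v x (k + 1) \<omega> + Cbar *\<^sub>v z k \<omega> + D *\<^sub>v v k \<omega>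
        - C *\<^sub>v (w k \<omega> \<cdot>\<^sub>v z k \<omega>)" for k
      using sys(4)[of _ k] by (intro AE_I2) (simp add: backward_def)
  qed (use sys(1-3) null Y in \<open>auto simp: l2_adapted_iff\<close>)
qed

section \<open>Necessity: duality\<close>

text \<open>The orthogonal complement of the span of the columns of \<open>R\<close>. Vectors
  \<open>W D u\<close> are used instead of columns so that matrices can be moved across the scalar
  product.\<close>

definition annihilator :: "real vec set" where
  "annihilator = {l \<in> carrier_vec n. \<forall>Ws\<in>words. \<forall>u\<in>carrier_vec p. l \<bullet> (word_mat n Ws *\<^sub>v (D *\<^sub>v u)) = 0}"

text \<open>Moving the transpose of \<open>W\<close> to the other side of the scalar product
  prepends the letter \<open>W\<close> to the word.\<close>

lemma annihilator_transpose:
  assumes "l \<in> annihilator" "W \<in> {C, Cbar}"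
  shows "W\<^sup>T *\<^sub>v l \<in> annihilator"
proof -
  have W: "W \<in> carrier_mat n n" and l: "l \<in> carrier_vec n"
    using assms by (auto simp: annihilator_def)
  have "(W\<^sup>T *\<^sub>v l) \<bullet> (word_mat n Ws *\<^sub>v (D *\<^sub>v u)) = 0" if "Ws \<in> words" "u \<in> carrier_vec p" for Ws u
  proof -
    have "D *\<^sub>v u \<in> carrier_vec n" using that D by simp
    then have "(W\<^sup>T *\<^sub>v l) \<bullet> (word_mat n Ws *\<^sub>v (D *\<^sub>v u)) = l \<bullet> (word_mat n (W # Ws) *\<^sub>v (D *\<^sub>v u))"
      using words_carrier[OF that(1)] W l
      by (simp add: transpose_vec_mult_scalar[OF W] word_mat_Cons)
    also have "\<dots> = 0"
      using assms that by (auto simp: annihilator_def)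
    finally show ?thesis .
  qed
  with W l show ?thesis by (simp add: annihilator_def)
qed

lemma scalar_prod_backward:
  assumes "l \<in> carrier_vec n" "x \<in> carrier_vec n" "z \<in> carrier_vec n" "v \<in> carrier_vec p"
  shows "l \<bullet> backward k \<omega> x z v =
    (C\<^sup>T *\<^sub>v l) \<bullet> x + (Cbar\<^sup>T *\<^sub>v l) \<bullet> z + (D\<^sup>T *\<^sub>v l) \<bullet> v - w k \<omega> * ((C\<^sup>T *\<^sub>v l) \<bullet> z)"
proof -
  have c: "C *\<^sub>v x \<in> carrier_vec n" "Cbar *\<^sub>v z \<in> carrier_vec n" "D *\<^sub>v v \<in> carrier_vec n"
    "C *\<^sub>v (w k \<omega> \<cdot>\<^sub>v z) \<in> carrier_vec n"
    using C Cbar D assms by auto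
  have "l \<bullet> backward k \<omega> x z v =
      l \<bullet> (C *\<^sub>v x) + l \<bullet> (Cbar *\<^sub>v z) + l \<bullet> (D *\<^sub>v v) - l \<bullet> (C *\<^sub>v (w k \<omega> \<cdot>\<^sub>v z))"
    unfolding backward_def using assms(1) c
    by (simp add: scalar_prod_add_distrib[of _ n] scalar_prod_minus_distrib[of _ n])
  then show ?thesis
    using assms by (simp add: transpose_vec_mult_scalar[OF C] transpose_vec_mult_scalar[OF Cbar]
        transpose_vec_mult_scalar[OF D] mult_mat_vec[OF C])
qed

text \<open>One step of the backward induction. The assumption \<open>null\<close> covers the whole
  annihilator because it is used for the images of \<open>l\<close> under the transposes of
  \<open>C\<close> and \<open>Cbar\<close>, not for \<open>l\<close> alone.\<close>

lemma annihilator_preserved_backward: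
  assumes x: "x \<in> L2_vec n k" and x': "x' \<in> L2_vec n (Suc k)"
    and z: "z \<in> L2_vec n k" and v: "v \<in> L2_vec p k"
    and eq: "AE \<omega> in P. x \<omega> = backward k \<omega> (x' \<omega>) (z \<omega>) (v \<omega>)"
    and null: "\<And>l. l \<in> annihilator \<Longrightarrow> AE \<omega> in P. l \<bullet> x' \<omega> = 0"
    and l: "l \<in> annihilator"
  shows "AE \<omega> in P. l \<bullet> x \<omega> = 0"
proof -
  have carrier: "l \<in> carrier_vec n" if "l \<in> annihilator" for l
    using that by (simp add: annihilator_def)
  have expand: "AE \<omega> in P. l \<bullet> x \<omega> = (C\<^sup>T *\<^sub>v l) \<bullet> x' \<omega> + (Cbar\<^sup>T *\<^sub>v l) \<bullet> z \<omega> + (D\<^sup>T *\<^sub>v l) \<bullet> v \<omega>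
      - w k \<omega> * ((C\<^sup>T *\<^sub>v l) \<bullet> z \<omega>)" if "l \<in> carrier_vec n" for l
    using eq AE_space
  proof eventually_elim
    case (elim \<omega>)
    show ?case
      unfolding elim(1)
      by (rule scalar_prod_backward[OF that L2_vec_carrier[OF x' elim(2)] L2_vec_carrier[OF z elim(2)]
            L2_vec_carrier[OF v elim(2)]])
  qed
  have z_null: "AE \<omega> in P. l \<bullet> z \<omega> = 0" if l: "l \<in> annihilator" for l
  proof -
    \<comment> \<open>Chosen so that the transpose of \<open>C\<close> maps \<open>r\<close> to
      \<open>l\<close>: pairing the equation with \<open>r\<close> gives \<open>x'\<close> the
      coefficient \<open>l\<close>, and that term vanishes by \<open>null\<close>.\<close>
    define r where "r = C'\<^sup>T *\<^sub>v l"
    have r: "r \<in> carrier_vec n"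
      unfolding r_def by (rule mult_mat_vec_carrier[of _ n n]) (use carrier[OF l] in auto)
    have "C\<^sup>T *\<^sub>v r = (C' * C)\<^sup>T *\<^sub>v l"
      unfolding r_def transpose_mult[OF C' C]
      by (rule assoc_mult_mat_vec[symmetric, of _ n n _ n]) (use carrier[OF l] in auto)
    then have Cr: "C\<^sup>T *\<^sub>v r = l"
      using carrier[OF l] by (simp add: C'_C)
    \<comment> \<open>The future state \<open>x'\<close> has dropped out, so only quantities of time
      \<open>k\<close> remain and \<open>?f\<close> lies in \<open>L2 k\<close>.\<close>
    let ?f = "\<lambda>\<omega>. r \<bullet> x \<omega> - (Cbar\<^sup>T *\<^sub>v r) \<bullet> z \<omega> - (D\<^sup>T *\<^sub>v r) \<bullet> v \<omega>"
    have "AE \<omega> in P. ?f \<omega> + w k \<omega> * (l \<bullet> z \<omega>) = 0"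
      using expand[OF r] null[OF l] by eventually_elim (simp add: Cr)
    moreover have "?f \<in> L2 k"
      by (intro L2_diff L2_scalar_prod[OF x] L2_scalar_prod[OF z] L2_scalar_prod[OF v])
    ultimately show ?thesis
      using noise_combination_zero(2)[OF _ L2_scalar_prod[OF z]] by blast
  qed
  have D_null: "(D\<^sup>T *\<^sub>v l) \<bullet> u = 0" if "u \<in> carrier_vec p" for u
  proof -
    \<comment> \<open>The empty word supplies the orthogonality of \<open>l\<close> to the range of
      \<open>D\<close>.\<close>
    have "(D\<^sup>T *\<^sub>v l) \<bullet> u = l \<bullet> (word_mat n [] *\<^sub>v (D *\<^sub>v u))"
      using carrier[OF l] that D by (simp add: word_mat_def transpose_vec_mult_scalar[OF D])
    also have "\<dots> = 0"
      using l that unfolding annihilator_def by blast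
    finally show ?thesis .
  qed
  have CT: "C\<^sup>T *\<^sub>v l \<in> annihilator" and CbarT: "Cbar\<^sup>T *\<^sub>v l \<in> annihilator"
    using annihilator_transpose[OF l] by auto
  show ?thesis
    using expand[OF carrier[OF l]] null[OF CT] z_null[OF CT] z_null[OF CbarT] AE_space
  proof eventually_elim
    case (elim \<omega>)
    then show ?case
      using D_null[OF L2_vec_carrier[OF v]] by simp
  qed
qed

text \<open>If the span were proper, some nonzero \<open>l\<close> would lie in the annihilator.
  Taking \<open>l\<close> itself as the initial state, the orthogonality carried back from the zero
  final state makes \<open>l\<close> orthogonal to itself.\<close>

lemma span_if_exactly_null_controllable:
  assumes "exactly_null_controllable P w n p C Cbar D"
  shows "V.span (R_cols n C Cbar D) = carrier_vec n"
proof (rule ccontr)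
  assume "V.span (R_cols n C Cbar D) \<noteq> carrier_vec n"
  then obtain l where l: "l \<in> carrier_vec n" "l \<noteq> 0\<^sub>v n"
    and orth: "\<And>s. s \<in> R_cols n C Cbar D \<Longrightarrow> s \<bullet> l = 0"
    using V.orthogonal_vec_exists[OF R_cols_carrier] by metis
  have "l \<bullet> (word_mat n Ws *\<^sub>v (D *\<^sub>v u)) = 0" if "Ws \<in> words" "u \<in> carrier_vec p" for Ws u
  proof -
    let ?X = "word_mat n Ws * D"
    have X: "?X \<in> carrier_mat n p"
      using words_carrier[OF that(1)] D by simp
    have "col ?X j \<bullet> l = 0" if "j < p" for j
    proof (rule orth)
      have "col ?X j \<in> set (cols ?X)"
        using that X by (simp add: cols_def)
      with \<open>Ws \<in> words\<close> show "col ?X j \<in> R_cols n C Cbar D"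
        unfolding R_cols_def by blast
    qed
    \<comment> \<open>Orthogonality to each column says that the transpose of \<open>?X\<close>
      kills \<open>l\<close>, and hence that \<open>l\<close> is orthogonal to the whole range of
      \<open>?X\<close>.\<close>
    then have "?X\<^sup>T *\<^sub>v l = 0\<^sub>v p"
      using X by (intro eq_vecI) auto
    then have "l \<bullet> (?X *\<^sub>v u) = 0"
      using transpose_vec_mult_scalar[OF X that(2) l(1)] that(2) by simp
    then show ?thesis
      using words_carrier[OF that(1)] D that(2) by simp
  qed
  with l have ann: "l \<in> annihilator"
    by (simp add: annihilator_def)
  obtain N v x z where v: "v \<in> l2_adapted P w N p" and x: "x \<in> l2_adapted P w (N + 1) n"
    and z: "z \<in> l2_adapted P w N n"
    and sys: "\<forall>k\<in>{0..N}. AE \<omega> in P. x k \<omega> = C *\<^sub>v x (k + 1) \<omega> + Cbar *\<^sub>v z k \<omega> + D *\<^sub>v v k \<omega>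
        - C *\<^sub>v (w k \<omega> \<cdot>\<^sub>v z k \<omega>)"
    and init: "AE \<omega> in P. x 0 \<omega> = l" and final: "AE \<omega> in P. x (N + 1) \<omega> = 0\<^sub>v n"
    using assms l unfolding exactly_null_controllable_def by blast
  have eq: "AE \<omega> in P. x k \<omega> = backward k \<omega> (x (Suc k) \<omega>) (z k \<omega>) (v k \<omega>)" if "k \<le> N" for k
    using sys that by (simp add: backward_def)
  have "\<forall>r\<in>annihilator. AE \<omega> in P. r \<bullet> x 0 \<omega> = 0"
  \<comment> \<open>The induction descends from \<open>N + 1\<close>, where the state is zero, to
    time 0.\<close>
  proof (rule inc_induct[of 0 "N + 1"])
    show "\<forall>r\<in>annihilator. AE \<omega> in P. r \<bullet> x (N + 1) \<omega> = 0"
    proof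
      fix r assume "r \<in> annihilator"
      then have "r \<bullet> 0\<^sub>v n = 0"
        by (simp add: annihilator_def)
      then show "AE \<omega> in P. r \<bullet> x (N + 1) \<omega> = 0"
        using final by (elim eventually_mono) simp
    qed
    fix k assume "k < N + 1" and null: "\<forall>r\<in>annihilator. AE \<omega> in P. r \<bullet> x (Suc k) \<omega> = 0"
    then have k: "k \<le> N" by simp
    have "x k \<in> L2_vec n k" "x (Suc k) \<in> L2_vec n (Suc k)" "z k \<in> L2_vec n k" "v k \<in> L2_vec p k"
      using v x z k by (simp_all add: l2_adapted_iff)
    note preserved = annihilator_preserved_backward[OF this eq[OF k]]
    show "\<forall>r\<in>annihilator. AE \<omega> in P. r \<bullet> x k \<omega> = 0"
      using null by (intro ballI preserved) auto
  qed simp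
  then have "AE \<omega> in P. l \<bullet> x 0 \<omega> = 0"
    using ann by blast
  with init have "AE \<omega> in P. l \<bullet> l = 0"
    by eventually_elim simp
  \<comment> \<open>The statement does not depend on the sample point, so under a probability
    measure it holds outright.\<close>
  then have "l \<bullet> l = 0"
    by simp
  with l show False
    using conjugate_square_eq_0_vec[OF l(1)] by simp
qed

end

section \<open>The matrix inverse and the conclusion\<close>

text \<open>Invertibility makes \<open>X\<close> a unit of the matrix ring, for which
  \<open>mat_inverse\<close> returns a value; hence \<open>the\<close> is applied to a genuine
  inverse.\<close>

lemma the_mat_inverse:
  fixes X :: "'a::field mat"
  assumes X: "X \<in> carrier_mat n n" and "invertible_mat X"
  shows "the (mat_inverse X) \<in> carrier_mat n n" "X * the (mat_inverse X) = 1\<^sub>m n"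
proof -
  obtain Y where XY: "X * Y = 1\<^sub>m n" and "Y * X = 1\<^sub>m (dim_row Y)"
    using assms by (auto simp: invertible_mat_def inverts_mat_def)
  \<comment> \<open>Comparing dimensions in the two product identities shows that \<open>Y\<close>
    is square of size \<open>n\<close>.\<close>
  then have "Y \<in> carrier_mat n n" "Y * X = 1\<^sub>m n"
    using X by (metis carrier_matD(2) carrier_matI index_mult_mat(2,3) index_one_mat(2,3))+
  with XY X have "X \<in> Units (ring_mat TYPE('a) n ())"
    by (auto simp: Units_def ring_mat_def)
  then obtain Z where "mat_inverse X = Some Z"
    using mat_inverse(1)[OF X, of "()"] by (cases "mat_inverse X") auto
  with mat_inverse(2)[OF X this]
  show "the (mat_inverse X) \<in> carrier_mat n n" "X * the (mat_inverse X) = 1\<^sub>m n"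
    by auto
qed

theorem theorem2:
  fixes P :: "'a measure" and w :: "nat \<Rightarrow> 'a \<Rightarrow> real"
    and n m :: nat
    and A Abar B Bbar M L F C Cbar D :: "real mat"
  assumes "prob_space P" and "complete_measure P"
    and "prob_space.indep_vars P (\<lambda>_. borel) w UNIV"
    and "\<And>k. distr P borel (w k) = distr P borel (w 0)"
    and "\<And>k. integrable P (\<lambda>\<omega>. (w k \<omega>)\<^sup>2)"
    and "\<And>k. prob_space.expectation P (w k) = 0"
    and "\<And>k. prob_space.variance P (w k) = 1"
    and "A \<in> carrier_mat n n" and "Abar \<in> carrier_mat n n"
    and "B \<in> carrier_mat n m" and "Bbar \<in> carrier_mat n m"
    and "vec_space.rank n Bbar = n"
    and "M \<in> carrier_mat m m" and "invertible_mat M"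
    and "Bbar * M = append_cols (1\<^sub>m n) (0\<^sub>m n (m - n))"
    and "L \<in> carrier_mat n n" and "F \<in> carrier_mat n (m - n)"
    and "B * M = append_cols L F"
    and "invertible_mat (A - L * Abar)"
    and "C = the (mat_inverse (A - L * Abar))"
    and "Cbar = - (C * L)"
    and "D = - (C * F)"
  shows "exactly_null_controllable P w n (m - n) C Cbar D
    \<longleftrightarrow> vec_space.rank_of_cols n (R_cols n C Cbar D) = n"
proof -
  \<comment> \<open>This matrix serves as the left inverse \<open>C'\<close> of \<open>C\<close> in
    \<open>backward_system\<close>.\<close>
  let ?C' = "A - L * Abar"
  have C': "?C' \<in> carrier_mat n n"
    using assms(8,9,16) by auto
  have C: "C \<in> carrier_mat n n" "?C' * C = 1\<^sub>m n"
    using the_mat_inverse[OF C' assms(19)] assms(20) by auto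
  interpret prob_space P by fact
  interpret backward_system P w n "m - n" C Cbar D ?C'
    by unfold_locales (use assms C C' in auto)
  show ?thesis
    using exactly_null_controllable_if_span span_if_exactly_null_controllable
      vec_space.rank_of_cols_eq_n_iff[OF R_cols_carrier] by auto
qed

end
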